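(* Let $m,n$ be integers with $2 \leq m < n$. Then $\mathrm{Hom}(K_2\times K_n, K_m)$ is homotopy equivalent to the sphere $S^{m-2}$.
   Context: A graph $G$ is a pair $(V(G),E(G))$ with $E(G)\subset V(G)\times V(G)$ symmetric (undirected graph; loops are allowed); $x\sim y$ means $(x,y)\in E(G)$. $K_n$ is the complete graph on $[n]=\{1,\dots,n\}$, without loops. Categorical product: $G\times H$ has vertex set $V(G)\times V(H)$, and $(g,h)\sim(g',h')$ iff $g\sim g'$ in $G$ and $h\sim h'$ in $H$. Hom complex: $\mathrm{Hom}(G,H)$ is the polyhedral complex whose cells are indexed by all functions $\eta:V(G)\to 2^{V(H)}\setminus\{\emptyset\}$ such that $(v,w)\in E(G)$ implies $\eta(v)\times\eta(w)\subset E(H)$; the cell $\eta$ is a face of the cell $\eta'$ iff $\eta(v)\subset\eta'(v)$ for all $v\in V(G)$. As a topological space it is the geometric realization of the order complex (simplicial complex of chains) of this face poset. *)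

theory Defs
  imports "HOL-Homology.Homology" "Graph_Theory.Pair_Digraph"
begin

text \<open>
  A graph in the sense used here (symmetric edge relation, loops allowed, no multiple edges) is a
  \<^typ>\<open>'a pair_pre_digraph\<close> satisfying \<^const>\<open>pair_sym_digraph\<close>; if it is moreover finite, it
  satisfies \<^const>\<open>pair_pseudo_graph\<close>.
\<close>

definition complete_graph :: "nat \<Rightarrow> nat pair_pre_digraph" where
  "complete_graph n = \<lparr>pverts = {1..n}, parcs = {(i, j). i \<in> {1..n} \<and> j \<in> {1..n} \<and> i \<noteq> j}\<rparr>"

definition categorical_product ::
    "'a pair_pre_digraph \<Rightarrow> 'b pair_pre_digraph \<Rightarrow> ('a \<times> 'b) pair_pre_digraph" where
  "categorical_product G H =
     \<lparr>pverts = pverts G \<times> pverts H,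
      parcs = {((g, h), (g', h')). (g, g') \<in> parcs G \<and> (h, h') \<in> parcs H}\<rparr>"

lemma pair_pseudo_graph_complete_graph: "pair_pseudo_graph (complete_graph n)"
proof
  show "finite (parcs (complete_graph n))"
    by (rule finite_subset[of _ "{1..n} \<times> {1..n}"]) (auto simp: complete_graph_def)
  show "symmetric (complete_graph n)"
    by (auto simp: symmetric_def complete_graph_def intro: symI)
qed (auto simp: complete_graph_def)

lemma pair_pseudo_graph_categorical_product:
  assumes "pair_pseudo_graph G" "pair_pseudo_graph H"
  shows "pair_pseudo_graph (categorical_product G H)"
proof -
  interpret G: pair_pseudo_graph G by fact
  interpret H: pair_pseudo_graph H by fact
  have wf: "parcs (categorical_product G H) \<subseteq>
      (pverts G \<times> pverts H) \<times> (pverts G \<times> pverts H)"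
    by (auto simp: categorical_product_def dest: G.wellformed' H.wellformed')
  have fin: "finite (pverts G \<times> pverts H)"
    using G.pair_finite_verts H.pair_finite_verts by simp
  show ?thesis
  proof
    show "finite (parcs (categorical_product G H))"
      using wf fin by (meson finite_SigmaI finite_subset)
    show "symmetric (categorical_product G H)"
      using G.pair_sym_arcs H.pair_sym_arcs
      by (auto simp: symmetric_def categorical_product_def sym_def)
  qed (use fin in \<open>auto simp: categorical_product_def dest: G.wellformed' H.wellformed'\<close>)
qed

text \<open>
  Cells are functions on \<open>V(G)\<close> only, hence the extensional function space.
\<close>

definition hom_cells :: "'a pair_pre_digraph \<Rightarrow> 'b pair_pre_digraph \<Rightarrow> ('a \<Rightarrow> 'b set) set" where
  "hom_cells G H =
     {\<eta> \<in> pverts G \<rightarrow>\<^sub>E Pow (pverts H) - {{}}. \<forall>(v, w) \<in> parcs G. \<eta> v \<times> \<eta> w \<subseteq> parcs H}"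

definition hom_face :: "'a pair_pre_digraph \<Rightarrow> ('a \<Rightarrow> 'b set) \<Rightarrow> ('a \<Rightarrow> 'b set) \<Rightarrow> bool" where
  "hom_face G \<eta> \<eta>' \<longleftrightarrow> (\<forall>v \<in> pverts G. \<eta> v \<subseteq> \<eta>' v)"

lemma finite_hom_cells:
  assumes "finite (pverts G)" "finite (pverts H)"
  shows "finite (hom_cells G H)"
proof -
  have "finite (pverts G \<rightarrow>\<^sub>E Pow (pverts H) - {{}})"
    using assms by (intro finite_PiE) auto
  then show ?thesis
    by (simp add: hom_cells_def)
qed

text \<open>Abstract simplicial complexes are given by their sets of (nonempty, finite) simplices.\<close>

definition order_complex :: "'a set \<Rightarrow> ('a \<Rightarrow> 'a \<Rightarrow> bool) \<Rightarrow> 'a set set" where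
  "order_complex P leq =
     {\<sigma>. \<sigma> \<noteq> {} \<and> finite \<sigma> \<and> \<sigma> \<subseteq> P \<and> Complete_Partial_Order.chain leq \<sigma>}"

text \<open>
  Points are given by their barycentric coordinates, extended by zero to the whole type. The
  topology is that of pointwise convergence of the coordinates. For a complex with finitely many
  vertices (such as the order complex of \<^term>\<open>hom_cells G H\<close> for finite \<open>G\<close>, \<open>H\<close>, see
  \<open>finite_hom_cells\<close>) this is the usual (weak) topology; for infinite complexes it may be coarser.
\<close>

definition geometric_realization :: "'a set set \<Rightarrow> ('a \<Rightarrow> real) topology" where
  "geometric_realization K =
     subtopology (powertop_real UNIV)
       {t. (\<forall>v. 0 \<le> t v) \<and> {v. t v \<noteq> 0} \<in> K \<and> (\<Sum>v | t v \<noteq> 0. t v) = 1}"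

definition Hom_complex ::
    "'a pair_pre_digraph \<Rightarrow> 'b pair_pre_digraph \<Rightarrow> (('a \<Rightarrow> 'b set) \<Rightarrow> real) topology" where
  "Hom_complex G H = geometric_realization (order_complex (hom_cells G H) (hom_face G))"

end

(*
A cell of Hom(K_2 x K_n, K_m) is a pair of families (A_i), (B_j) of nonempty subsets of [m] with
A_i disjoint from B_j for i \<noteq> j. Let R(A) be the set of vertices lying in at least two of the A_i;
it is nonempty by the pigeonhole principle as m < n, and it misses every B_j. Hence
  (A_i, B_j) \<le> (A_i \<union> R(A), B_j \<union> R(B)) \<ge> (R(A), R(B)),
and all these maps are monotone, so the cell poset is homotopy equivalent to the poset of pairs of
disjoint nonempty subsets of [m]. The map sending a weighted chain of such pairs to the weighted sum
of the vectors 1_A - 1_B identifies the order complex of the latter with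
{x : max x = 1, min x = -1}, which meets the class of every nonconstant vector modulo positive scaling
and addition of constants exactly once, and so is the sphere of R^m/R(1,...,1).
*)
theory Submission
  imports Defs "HOL-Analysis.Analysis"
begin

section \<open>Order complexes of finite posets\<close>

text \<open>The points of the realization for the type class order. The total is taken over the
  fixed set \<open>P\<close> rather than the varying support, so for finite \<open>P\<close> it is
  continuous in \<open>t\<close>; the chain condition becomes pairwise comparability of the
  support.\<close>

definition chain_weights :: "'a::order set \<Rightarrow> ('a \<Rightarrow> real) set" where
  "chain_weights P =
     {t. (\<forall>v. 0 \<le> t v) \<and> (\<forall>v. v \<notin> P \<longrightarrow> t v = 0) \<and> sum t P = 1 \<and>
         (\<forall>v w. t v \<noteq> 0 \<longrightarrow> t w \<noteq> 0 \<longrightarrow> v \<le> w \<or> w \<le> v)}"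

abbreviation order_realization :: "'a::order set \<Rightarrow> ('a \<Rightarrow> real) topology" where
  "order_realization P \<equiv> subtopology (powertop_real UNIV) (chain_weights P)"

lemma chain_weightsD:
  assumes "t \<in> chain_weights P"
  shows "0 \<le> t v" "v \<notin> P \<Longrightarrow> t v = 0" "sum t P = 1"
    "t v \<noteq> 0 \<Longrightarrow> t w \<noteq> 0 \<Longrightarrow> v \<le> w \<or> w \<le> v"
  using assms by (auto simp: chain_weights_def)

lemma geometric_realization_order_complex:
  assumes "finite P"
  shows "geometric_realization (order_complex P (\<le>)) = order_realization P"
proof -
  have "{t. (\<forall>v. 0 \<le> t v) \<and> {v. t v \<noteq> 0} \<in> order_complex P (\<le>) \<and>
          (\<Sum>v | t v \<noteq> 0. t v) = 1} = chain_weights P" (is "?L = _")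
  proof (intro Set.set_eqI iffI)
    fix t assume t: "t \<in> ?L"
    then have sub: "{v. t v \<noteq> 0} \<subseteq> P"
      by (auto simp: order_complex_def)
    then have "sum t P = (\<Sum>v | t v \<noteq> 0. t v)"
      by (intro sum.mono_neutral_right assms) auto
    with t sub show "t \<in> chain_weights P"
      unfolding chain_weights_def order_complex_def Complete_Partial_Order.chain_def by auto
  next
    fix t assume t: "t \<in> chain_weights P"
    have sub: "{v. t v \<noteq> 0} \<subseteq> P"
      using chain_weightsD(2)[OF t] by auto
    then have "(\<Sum>v | t v \<noteq> 0. t v) = sum t P"
      by (intro sum.mono_neutral_left assms) auto
    moreover have "finite {v. t v \<noteq> 0}"
      using sub assms finite_subset by blast
    moreover have "{v. t v \<noteq> 0} \<noteq> {}"
      using chain_weightsD(3)[OF t] by (metis (mono_tags) Collect_empty_eq sum.neutral zero_neq_one)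
    ultimately show "t \<in> ?L"
      using sub t unfolding chain_weights_def order_complex_def Complete_Partial_Order.chain_def
      by auto
  qed
  then show ?thesis
    by (simp add: geometric_realization_def)
qed

lemma order_complex_cong:
  assumes "\<And>x y. x \<in> P \<Longrightarrow> y \<in> P \<Longrightarrow> R x y \<longleftrightarrow> S x y"
  shows "order_complex P R = order_complex P S"
  using assms unfolding order_complex_def Complete_Partial_Order.chain_def by blast

lemma chain_weights_least:
  assumes "finite P" "t \<in> chain_weights P"
  obtains p where "p \<in> P" "t p \<noteq> 0" "\<And>q. t q \<noteq> 0 \<Longrightarrow> p \<le> q"
proof -
  have "finite {v. t v \<noteq> 0}"
    using assms by (auto intro: finite_subset[of _ P] simp: chain_weights_def)
  moreover have "{v. t v \<noteq> 0} \<noteq> {}"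
    using chain_weightsD(3)[OF assms(2)]
    by (metis (mono_tags) Collect_empty_eq sum.neutral zero_neq_one)
  ultimately obtain p where p: "t p \<noteq> 0" "\<And>q. t q \<noteq> 0 \<Longrightarrow> q \<le> p \<Longrightarrow> p = q"
    using finite_has_minimal[of "{v. t v \<noteq> 0}"] by blast
  show thesis
    using p chain_weightsD(2,4)[OF assms(2)] by (intro that[of p]) blast+
qed

text \<open>A closed subset of the cube of all functions into [0,1], which is compact by Tychonoff.
  Comparability of the support is a closed condition once it is read as \<open>t v * t w = 0\<close>
  for incomparable \<open>v\<close> and \<open>w\<close>.\<close>

lemma compact_space_order_realization:
  assumes "finite P"
  shows "compact_space (order_realization P)"
proof -
  let ?T = "powertop_real (UNIV :: 'a set)"
  have proj: "continuous_map ?T euclideanreal (\<lambda>t. t v)" for v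
    by (intro continuous_map_product_projection) simp
  have cl: "closedin ?T {t. f t \<in> C}" if "continuous_map ?T euclideanreal f" "closed C" for f C
    using closedin_continuous_map_preimage[OF that(1), of C] that(2) by simp
  have "{t. t v = 0 \<or> t w = 0} = {t. t v * t w \<in> {0::real}}" for v w :: 'a
    by auto
  then have cl2: "closedin ?T {t. t v = 0 \<or> t w = 0}" for v w
    using cl[OF continuous_map_real_mult[OF proj proj], of "{0}" v w] by simp
  \<comment> \<open>Adjoining \<open>UNIV\<close> keeps the intersected families nonempty even if
    \<open>P\<close> is everything or the order is total.\<close>
  have "chain_weights P =
      {t. sum t P \<in> {1}} \<inter> (\<Inter>v. {t. t v \<in> {0..}}) \<inter>
      \<Inter>({UNIV} \<union> (\<lambda>v. {t. t v \<in> {0}}) ` (-P)) \<inter>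
      \<Inter>({UNIV} \<union> (\<lambda>(v, w). {t. t v = 0 \<or> t w = 0}) ` {(v, w). \<not> (v \<le> w \<or> w \<le> v)})"
    by (auto simp: chain_weights_def)
  also have "closedin ?T \<dots>"
    using assms
    by (intro closedin_Int closedin_Inter cl continuous_map_sum proj)
      (auto intro!: cl2 cl[of "\<lambda>t. t _" "{0}", simplified] cl[of "\<lambda>t. t _" "{0..}", simplified] proj
        simp: closedin_topspace[of ?T, simplified])
  finally have closed: "closedin ?T (chain_weights P)" .
  have "chain_weights P \<subseteq> PiE UNIV (\<lambda>_. {0..1})"
  proof
    fix t assume t: "t \<in> chain_weights P"
    have "t v \<le> 1" for v
    proof (cases "v \<in> P")
      case True
      then show ?thesis
        using member_le_sum[of v P t] assms chain_weightsD[OF t] by simp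
    qed (use chain_weightsD[OF t] in auto)
    then show "t \<in> PiE UNIV (\<lambda>_. {0..1})"
      using chain_weightsD[OF t] by auto
  qed
  moreover have "compactin ?T (PiE UNIV (\<lambda>_. {0..1}))"
    by (simp add: compactin_PiE)
  ultimately have "compactin ?T (chain_weights P)"
    using closed closed_compactin by blast
  then show ?thesis
    by (simp add: compactin_subspace)
qed

section \<open>Homotopies between comparable monotone maps\<close>

text \<open>
  The part of the mass at \<^term>\<open>p\<close> that belongs to the top \<^term>\<open>s\<close> of the total mass along the
  chain supporting \<^term>\<open>t\<close>.
\<close>
definition top_mass :: "'a::order set \<Rightarrow> real \<Rightarrow> ('a \<Rightarrow> real) \<Rightarrow> 'a \<Rightarrow> real" where
  "top_mass P s t p = min (t p) (max 0 (s - (\<Sum>q | q \<in> P \<and> p < q. t q)))"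

definition push_mix ::
    "'a::order set \<Rightarrow> ('a \<Rightarrow> 'b) \<Rightarrow> ('a \<Rightarrow> 'b) \<Rightarrow> real \<Rightarrow> ('a \<Rightarrow> real) \<Rightarrow> 'b \<Rightarrow> real" where
  "push_mix P f g s t q =
     (\<Sum>p\<in>P. (if f p = q then t p - top_mass P s t p else 0) +
             (if g p = q then top_mass P s t p else 0))"

text \<open>Pushforward of a measure; for monotone \<open>f\<close> this is the simplicial map that
  \<open>f\<close> induces on order complexes.\<close>

definition push :: "'a set \<Rightarrow> ('a \<Rightarrow> 'b) \<Rightarrow> ('a \<Rightarrow> real) \<Rightarrow> 'b \<Rightarrow> real" where
  "push P f t q = (\<Sum>p\<in>P. if f p = q then t p else 0)"

text \<open>Cutting the mass at level \<open>s\<close> splits the supporting chain so that every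
  point with mass left for \<open>f\<close> lies below or equals every point with mass taken by
  \<open>g\<close>. For such \<open>p\<close> and \<open>q\<close> one gets
  \<open>f p \<le> f q \<le> g q\<close>, and two images under the same map are comparable by
  monotonicity, so the new support is again a chain.\<close>

lemma push_mix_mem_chain_weights:
  fixes P :: "'a::order set" and Q :: "'b::order set"
  assumes fin: "finite P" "finite Q"
    and f: "f \<in> P \<rightarrow> Q" "mono_on P f" and g: "g \<in> P \<rightarrow> Q" "mono_on P g"
    and le: "\<And>p. p \<in> P \<Longrightarrow> f p \<le> g p"
    and t: "t \<in> chain_weights P"
  shows "push_mix P f g s t \<in> chain_weights Q"
proof -
  note tD = chain_weightsD[OF t]
  let ?w = "top_mass P s t"
  have w: "0 \<le> ?w p" "?w p \<le> t p" for p
    using tD(1)[of p] by (auto simp: top_mass_def)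
  \<comment> \<open>If \<open>q < p\<close>, the mass strictly above \<open>q\<close> is at least
    the mass at or above \<open>p\<close>. The latter exceeds \<open>s\<close> because some mass at
    \<open>p\<close> is not top mass, while the former is below \<open>s\<close> because some mass
    at \<open>q\<close> is: a contradiction.\<close>
  have chain: "p \<le> q" if pq: "p \<in> P" "q \<in> P" "t p - ?w p \<noteq> 0" "?w q \<noteq> 0" for p q
  proof -
    have np: "t p \<noteq> 0" and nq: "t q \<noteq> 0"
      using pq(3,4) w[of p] w[of q] by linarith+
    have "\<not> q < p"
    proof
      assume "q < p"
      then have "insert p {r \<in> P. p < r} \<subseteq> {r \<in> P. q < r}"
        using pq by auto
      then have "sum t (insert p {r \<in> P. p < r}) \<le> sum t {r \<in> P. q < r}"
        using fin tD(1) by (intro sum_mono2) auto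
      then have "t p + sum t {r \<in> P. p < r} \<le> sum t {r \<in> P. q < r}"
        using fin by simp
      moreover have "s - sum t {r \<in> P. p < r} < t p"
        using pq(3) tD(1)[of p] unfolding top_mass_def by linarith
      moreover have "0 < s - sum t {r \<in> P. q < r}"
        using pq(4) tD(1)[of q] unfolding top_mass_def by linarith
      ultimately show False
        by simp
    qed
    then show ?thesis
      using tD(4)[OF np nq] by auto
  qed
  let ?S = "f ` {p \<in> P. t p - ?w p \<noteq> 0} \<union> g ` {p \<in> P. ?w p \<noteq> 0}"
  have supp: "q \<in> ?S" if nz: "push_mix P f g s t q \<noteq> 0" for q
  proof -
    obtain p where p: "p \<in> P" "(if f p = q then t p - ?w p else 0) + (if g p = q then ?w p else 0) \<noteq> 0"
      using nz[unfolded push_mix_def] by (rule sum.not_neutral_contains_not_neutral)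
    then have "f p = q \<and> t p - ?w p \<noteq> 0 \<or> g p = q \<and> ?w p \<noteq> 0"
      by (cases "f p = q"; cases "g p = q") simp_all
    with p(1) show ?thesis
      by blast
  qed
  have comp: "x \<le> y \<or> y \<le> x" if xy: "x \<in> ?S" "y \<in> ?S" for x y
  proof -
    have tc: "p \<le> q \<or> q \<le> p"
      if "t p - ?w p \<noteq> 0 \<or> ?w p \<noteq> 0" "t q - ?w q \<noteq> 0 \<or> ?w q \<noteq> 0" for p q
    proof -
      have "t p \<noteq> 0" "t q \<noteq> 0"
        using that w[of p] w[of q] by linarith+
      then show ?thesis
        by (rule tD(4))
    qed
    have ff: "f p \<le> f q \<or> f q \<le> f p"
      if "p \<in> P" "q \<in> P" "t p - ?w p \<noteq> 0" "t q - ?w q \<noteq> 0" for p q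
      using tc[of p q] that(3,4) mono_onD[OF f(2) that(1,2)] mono_onD[OF f(2) that(2,1)] by blast
    have gg: "g p \<le> g q \<or> g q \<le> g p"
      if "p \<in> P" "q \<in> P" "?w p \<noteq> 0" "?w q \<noteq> 0" for p q
      using tc[of p q] that(3,4) mono_onD[OF g(2) that(1,2)] mono_onD[OF g(2) that(2,1)] by blast
    have fg: "f p \<le> g q" if "p \<in> P" "q \<in> P" "t p - ?w p \<noteq> 0" "?w q \<noteq> 0" for p q
      by (rule order_trans[OF mono_onD[OF f(2) that(1,2) chain[OF that]] le[OF that(2)]])
    obtain p where p: "p \<in> P" "x = f p \<and> t p - ?w p \<noteq> 0 \<or> x = g p \<and> ?w p \<noteq> 0"
      using xy(1) by blast
    obtain q where q: "q \<in> P" "y = f q \<and> t q - ?w q \<noteq> 0 \<or> y = g q \<and> ?w q \<noteq> 0"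
      using xy(2) by blast
    show ?thesis
      using p(2) q(2) ff[OF p(1) q(1)] gg[OF p(1) q(1)] fg[OF p(1) q(1)] fg[OF q(1) p(1)]
      by metis
  qed
  have "sum (push_mix P f g s t) Q =
      (\<Sum>p\<in>P. \<Sum>q\<in>Q. (if f p = q then t p - ?w p else 0) + (if g p = q then ?w p else 0))"
    unfolding push_mix_def by (rule sum.swap)
  also have "\<dots> = sum t P"
  proof (rule sum.cong[OF refl])
    fix p assume "p \<in> P"
    then have "f p \<in> Q" "g p \<in> Q"
      using f g by auto
    then show "(\<Sum>q\<in>Q. (if f p = q then t p - ?w p else 0) + (if g p = q then ?w p else 0)) = t p"
      using fin by (simp add: sum.distrib)
  qed
  finally have "sum (push_mix P f g s t) Q = 1"
    using tD(3) by simp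
  moreover have "0 \<le> push_mix P f g s t q" for q
    unfolding push_mix_def using w by (intro sum_nonneg) auto
  moreover have "push_mix P f g s t q = 0" if "q \<notin> Q" for q
    using supp[of q] that f(1) g(1) by (auto simp: Pi_def)
  moreover have "x \<le> y \<or> y \<le> x" if "push_mix P f g s t x \<noteq> 0" "push_mix P f g s t y \<noteq> 0" for x y
    by (rule comp[OF supp[OF that(1)] supp[OF that(2)]])
  ultimately show ?thesis
    by (simp add: chain_weights_def)
qed

text \<open>
  The straight-line homotopy would leave the complex. Instead, at time \<open>s\<close> the top \<open>s\<close> of the mass
  is moved by \<^term>\<open>g\<close> and the rest by \<^term>\<open>f\<close>.
\<close>
lemma homotopic_push:
  fixes P :: "'a::order set" and Q :: "'b::order set"
  assumes fin: "finite P" "finite Q"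
    and f: "f \<in> P \<rightarrow> Q" "mono_on P f" and g: "g \<in> P \<rightarrow> Q" "mono_on P g"
    and le: "\<And>p. p \<in> P \<Longrightarrow> f p \<le> g p"
  shows "homotopic_with (\<lambda>_. True) (order_realization P) (order_realization Q) (push P f) (push P g)"
proof -
  let ?I = "prod_topology (top_of_set {0..1::real}) (order_realization P)"
  have s: "continuous_map ?I euclideanreal fst"
    using continuous_map_fst continuous_map_into_fulltopology by blast
  have t: "continuous_map ?I euclideanreal (\<lambda>x. snd x p)" for p
  proof -
    have "continuous_map (order_realization P) euclideanreal (\<lambda>t. t p)"
      by (intro continuous_map_from_subtopology continuous_map_product_projection) simp
    from continuous_map_compose[OF continuous_map_snd this] show ?thesis
      by (simp add: o_def)
  qed
  have w: "continuous_map ?I euclideanreal (\<lambda>x. top_mass P (fst x) (snd x) p)" for p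
    unfolding top_mass_def using fin(1)
    by (intro continuous_map_real_min continuous_map_real_max continuous_map_diff
        continuous_map_sum s t continuous_map_const[THEN iffD2]) auto
  have "continuous_map ?I euclideanreal (\<lambda>x. push_mix P f g (fst x) (snd x) q)" for q
    unfolding push_mix_def
  proof (intro continuous_map_sum fin(1) continuous_map_add)
    fix p
    show "continuous_map ?I euclideanreal
        (\<lambda>x. if f p = q then snd x p - top_mass P (fst x) (snd x) p else 0)"
      by (cases "f p = q") (auto intro!: continuous_map_diff t w)
    show "continuous_map ?I euclideanreal
        (\<lambda>x. if g p = q then top_mass P (fst x) (snd x) p else 0)"
      by (cases "g p = q") (auto intro!: w)
  qed
  then have cont: "continuous_map ?I (order_realization Q) (\<lambda>x. push_mix P f g (fst x) (snd x))"
    using push_mix_mem_chain_weights[OF fin f g le]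
    by (auto simp: continuous_map_in_subtopology continuous_map_componentwise_UNIV)
  have start: "push_mix P f g 0 t = push P f t" if "t \<in> chain_weights P" for t
  proof -
    have "0 \<le> (\<Sum>q | q \<in> P \<and> p < q. t q)" for p
      using chain_weightsD(1)[OF that] by (simp add: sum_nonneg)
    then have "top_mass P 0 t p = 0" for p
      using chain_weightsD(1)[OF that]
      by (simp add: top_mass_def max_absorb1)
    then show ?thesis
      by (auto simp: push_mix_def push_def fun_eq_iff intro!: sum.cong)
  qed
  have stop: "push_mix P f g 1 t = push P g t" if t: "t \<in> chain_weights P" for t
  proof -
    have "top_mass P 1 t p = t p" if "p \<in> P" for p
    proof -
      \<comment> \<open>The mass at \<open>p\<close> and strictly above it is at most the total 1,
        so at level 1 all the mass at \<open>p\<close> is top mass.\<close>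
      have "sum t (insert p {q \<in> P. p < q}) \<le> sum t P"
        using fin chain_weightsD(1)[OF t] that by (intro sum_mono2) auto
      then have "t p + (\<Sum>q | q \<in> P \<and> p < q. t q) \<le> 1"
        using fin chain_weightsD(3)[OF t] by simp
      then show ?thesis
        by (auto simp: top_mass_def min_def max_def)
    qed
    then show ?thesis
      by (auto simp: push_mix_def push_def fun_eq_iff intro!: sum.cong)
  qed
  show ?thesis
    by (subst homotopic_with, simp, rule exI[of _ "\<lambda>x. push_mix P f g (fst x) (snd x)"])
      (use cont start stop in simp)
qed

text \<open>Functoriality of the pushforward. Since the outer sum runs over \<open>Q\<close> only,
  mass sent by \<open>f\<close> outside \<open>Q\<close> would be lost.\<close>

lemma push_push:
  assumes "finite P" "finite Q" "f \<in> P \<rightarrow> Q"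
  shows "push Q g (push P f t) = push P (g \<circ> f) t"
proof
  fix r
  have "push Q g (push P f t) r = (\<Sum>q\<in>Q. \<Sum>p\<in>P. if f p = q then if g q = r then t p else 0 else 0)"
  proof -
    have "(if g q = r then push P f t q else 0) =
        (\<Sum>p\<in>P. if f p = q then if g q = r then t p else 0 else 0)" for q
    proof (cases "g q = r")
      case False
      then have "(if f p = q then if g q = r then t p else 0 else 0) = 0" for p
        by simp
      with False show ?thesis
        by (simp only: sum.neutral_const if_False)
    qed (auto simp: push_def intro!: sum.cong)
    then show ?thesis
      by (simp add: push_def[of Q])
  qed
  also have "\<dots> = (\<Sum>p\<in>P. \<Sum>q\<in>Q. if f p = q then if g q = r then t p else 0 else 0)"
    by (rule sum.swap)
  also have "\<dots> = (\<Sum>p\<in>P. if g (f p) = r then t p else 0)"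
    using assms by (intro sum.cong refl) (auto simp: Pi_def)
  finally show "push Q g (push P f t) r = push P (g \<circ> f) t r"
    by (simp add: push_def)
qed

lemma push_id:
  assumes "finite P" "t \<in> chain_weights P" "\<And>p. p \<in> P \<Longrightarrow> f p = p"
  shows "push P f t = t"
proof
  fix q
  have "push P f t q = (\<Sum>p\<in>P. if p = q then t p else 0)"
    unfolding push_def using assms(3) by (intro sum.cong) auto
  also have "\<dots> = t q"
    using assms(1) chain_weightsD(2)[OF assms(2), of q] by simp
  finally show "push P f t q = t q" .
qed

text \<open>The composite \<open>r \<circ> c\<close> is the identity on \<open>Q\<close>, so only
  \<open>c \<circ> r\<close> needs a homotopy. It need not be comparable with the identity, but both
  lie below \<open>g\<close>, and two applications of \<open>homotopic_push\<close> meet at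
  \<open>push P g\<close>.\<close>

lemma homotopy_equivalent_order_realization:
  fixes P :: "'a::order set" and Q :: "'b::order set"
  assumes fin: "finite P" "finite Q"
    and r: "r \<in> P \<rightarrow> Q" "mono_on P r" and c: "c \<in> Q \<rightarrow> P" "mono_on Q c"
    and rc: "\<And>q. q \<in> Q \<Longrightarrow> r (c q) = q"
    and g: "g \<in> P \<rightarrow> P" "mono_on P g"
    and le: "\<And>p. p \<in> P \<Longrightarrow> p \<le> g p" "\<And>p. p \<in> P \<Longrightarrow> c (r p) \<le> g p"
  shows "order_realization P homotopy_equivalent_space order_realization Q"
proof -
  have cr: "c \<circ> r \<in> P \<rightarrow> P" "mono_on P (c \<circ> r)"
    using r c by (auto simp: Pi_def mono_on_def)
  have "homotopic_with (\<lambda>_. True) (order_realization P) (order_realization P)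
      (push P (c \<circ> r)) (push P g)"
    using homotopic_push[OF fin(1,1) cr g] le by simp
  moreover have "homotopic_with (\<lambda>_. True) (order_realization P) (order_realization P)
      (push P id) (push P g)"
    using homotopic_push[OF fin(1,1) _ _ g, of id] le by (simp add: mono_on_def)
  ultimately have "homotopic_with (\<lambda>_. True) (order_realization P) (order_realization P)
      (push P (c \<circ> r)) (push P id)"
    using homotopic_with_sym homotopic_with_trans by blast
  then have 1: "homotopic_with (\<lambda>_. True) (order_realization P) (order_realization P)
      (push Q c \<circ> push P r) id"
    by (rule homotopic_with_eq)
      (simp_all add: push_push[OF fin r(1)] push_id[OF fin(1)])
  \<comment> \<open>Continuity of a single pushforward is read off from the homotopy from a map to
    itself.\<close>
  have contr: "continuous_map (order_realization P) (order_realization Q) (push P r)"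
    using homotopic_with_imp_continuous_maps[OF homotopic_push[OF fin r r order_refl]] by simp
  have contc: "continuous_map (order_realization Q) (order_realization P) (push Q c)"
    using homotopic_with_imp_continuous_maps[OF homotopic_push[OF fin(2,1) c c order_refl]] by simp
  have "homotopic_with (\<lambda>_. True) (order_realization Q) (order_realization Q)
      (push P r \<circ> push Q c) id"
  proof (rule homotopic_with_equal)
    show "(push P r \<circ> push Q c) t = id t" if "t \<in> topspace (order_realization Q)" for t
      using that push_id[OF fin(2), of t "r \<circ> c"] rc by (simp add: push_push[OF fin(2,1) c(1)])
  qed (simp_all add: continuous_map_compose[OF contc contr])
  with 1 contr contc show ?thesis
    unfolding homotopy_equivalent_space_def by blast
qed

section \<open>Pairs of disjoint nonempty sets\<close>

text \<open>For \<open>I = {1..m}\<close> this is the cell poset of Hom(K_2, K_m), ordered by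
  componentwise inclusion.\<close>

definition disjoint_pairs :: "'a set \<Rightarrow> ('a set \<times> 'a set) set" where
  "disjoint_pairs I = {(A, B). A \<subseteq> I \<and> B \<subseteq> I \<and> A \<noteq> {} \<and> B \<noteq> {} \<and> A \<inter> B = {}}"

lemma finite_disjoint_pairs: "finite I \<Longrightarrow> finite (disjoint_pairs I)"
  by (rule finite_subset[of _ "Pow I \<times> Pow I"]) (auto simp: disjoint_pairs_def)

section \<open>Embedding weighted chains of pairs into Euclidean space\<close>

definition pos_mass :: "'a set \<Rightarrow> ('a set \<times> 'a set \<Rightarrow> real) \<Rightarrow> 'a \<Rightarrow> real" where
  "pos_mass I t i = (\<Sum>p\<in>disjoint_pairs I. if i \<in> fst p then t p else 0)"

definition neg_mass :: "'a set \<Rightarrow> ('a set \<times> 'a set \<Rightarrow> real) \<Rightarrow> 'a \<Rightarrow> real" where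
  "neg_mass I t i = (\<Sum>p\<in>disjoint_pairs I. if i \<in> snd p then t p else 0)"

text \<open>The coordinate at \<open>i\<close> of the sum of the vectors 1_A - 1_B weighted by
  \<open>t\<close>.\<close>

definition signed_mass :: "'a set \<Rightarrow> ('a set \<times> 'a set \<Rightarrow> real) \<Rightarrow> 'a \<Rightarrow> real" where
  "signed_mass I t i = pos_mass I t i - neg_mass I t i"

definition upper_mass :: "'a::order set \<Rightarrow> ('a \<Rightarrow> real) \<Rightarrow> 'a \<Rightarrow> real" where
  "upper_mass P t p = (\<Sum>q\<in>P. if p \<le> q then t q else 0)"

text \<open>At a maximal \<open>p\<close> where the weights differ, all contributions from strictly
  above \<open>p\<close> agree, so the upper masses at \<open>p\<close> differ by exactly
  \<open>t p - t' p\<close>.\<close>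

lemma chain_weights_eqI:
  assumes "finite P" "t \<in> chain_weights P" "t' \<in> chain_weights P"
    and "\<And>p. p \<in> P \<Longrightarrow> upper_mass P t p = upper_mass P t' p"
  shows "t = t'"
proof (rule ccontr)
  assume "t \<noteq> t'"
  then obtain p0 where "t p0 \<noteq> t' p0"
    by blast
  then have "{p \<in> P. t p \<noteq> t' p} \<noteq> {}"
    using chain_weightsD(2)[OF assms(2)] chain_weightsD(2)[OF assms(3)] by force
  then obtain p where p: "p \<in> P" "t p \<noteq> t' p"
    and max: "\<And>q. q \<in> P \<Longrightarrow> t q \<noteq> t' q \<Longrightarrow> p \<le> q \<Longrightarrow> p = q"
    using finite_has_maximal[of "{p \<in> P. t p \<noteq> t' p}"] assms(1) by auto
  have "0 = upper_mass P t p - upper_mass P t' p"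
    using assms(4)[OF p(1)] by simp
  also have "\<dots> = (\<Sum>q\<in>P. if p \<le> q then t q - t' q else 0)"
    unfolding upper_mass_def sum_subtractf[symmetric] by (rule sum.cong) auto
  also have "\<dots> = (\<Sum>q\<in>P. if p = q then t q - t' q else 0)"
    using max by (intro sum.cong) auto
  also have "\<dots> = t p - t' p"
    using assms(1) p(1) by simp
  finally show False
    using p(2) by simp
qed

context
  fixes I :: "'a set" and t :: "'a set \<times> 'a set \<Rightarrow> real"
  assumes finite_index: "finite I" and weights: "t \<in> chain_weights (disjoint_pairs I)"
begin

lemma mass_nonneg: "0 \<le> pos_mass I t i" "0 \<le> neg_mass I t i"
  using chain_weightsD(1)[OF weights] by (simp_all add: pos_mass_def neg_mass_def sum_nonneg)

lemma mass_le_1: "pos_mass I t i \<le> 1" "neg_mass I t i \<le> 1"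
  unfolding pos_mass_def neg_mass_def chain_weightsD(3)[OF weights, symmetric]
  using chain_weightsD(1)[OF weights] by (auto intro!: sum_mono)

text \<open>Otherwise \<open>i\<close> lies in the first set of one supporting pair and in the
  second set of another. These pairs are comparable, so the larger one contains \<open>i\<close> on
  both sides, against disjointness. Consequently the two masses are the positive and negative parts
  of the signed mass.\<close>

lemma pos_mass_zero_or_neg_mass_zero: "pos_mass I t i = 0 \<or> neg_mass I t i = 0"
proof (rule ccontr)
  assume nz: "\<not> ?thesis"
  have "pos_mass I t i \<noteq> 0" "neg_mass I t i \<noteq> 0"
    using nz by blast+
  obtain p where p: "p \<in> disjoint_pairs I" "(if i \<in> fst p then t p else 0) \<noteq> 0"
    using \<open>pos_mass I t i \<noteq> 0\<close>[unfolded pos_mass_def]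
    by (rule sum.not_neutral_contains_not_neutral)
  obtain q where q: "q \<in> disjoint_pairs I" "(if i \<in> snd q then t q else 0) \<noteq> 0"
    using \<open>neg_mass I t i \<noteq> 0\<close>[unfolded neg_mass_def]
    by (rule sum.not_neutral_contains_not_neutral)
  have "p \<le> q \<or> q \<le> p"
    using p q by (intro chain_weightsD(4)[OF weights]) (auto split: if_splits)
  moreover have "i \<in> fst p" "i \<in> snd q"
    using p q by (auto split: if_splits)
  ultimately have "i \<in> fst p \<inter> snd p \<or> i \<in> fst q \<inter> snd q"
    by (auto simp: less_eq_prod_def)
  then show False
    using p(1) q(1) by (auto simp: disjoint_pairs_def)
qed

lemma pos_mass_eq: "pos_mass I t i = max 0 (signed_mass I t i)"
  using pos_mass_zero_or_neg_mass_zero[of i] mass_nonneg[of i] by (auto simp: signed_mass_def)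

lemma neg_mass_eq: "neg_mass I t i = max 0 (- signed_mass I t i)"
  using pos_mass_zero_or_neg_mass_zero[of i] mass_nonneg[of i] by (auto simp: signed_mass_def)

lemma signed_mass_bounds: "- 1 \<le> signed_mass I t i" "signed_mass I t i \<le> 1"
  using mass_nonneg[of i] mass_le_1[of i] by (auto simp: signed_mass_def)

text \<open>The least supporting pair is contained in all the others, so an element of its first or
  second set collects the whole mass 1 on that side.\<close>

lemma signed_mass_extremal:
  shows "\<exists>i\<in>I. signed_mass I t i = 1" "\<exists>i\<in>I. signed_mass I t i = - 1"
proof -
  obtain p where p: "p \<in> disjoint_pairs I" "\<And>q. t q \<noteq> 0 \<Longrightarrow> p \<le> q"
    using chain_weights_least[OF finite_disjoint_pairs[OF finite_index] weights] by metis
  obtain i j where ij: "i \<in> fst p" "j \<in> snd p"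
    using p(1) unfolding disjoint_pairs_def by (cases p) auto
  then have I: "i \<in> I" "j \<in> I"
    using p(1) by (auto simp: disjoint_pairs_def)
  have "pos_mass I t i = sum t (disjoint_pairs I)"
    unfolding pos_mass_def using p(2) ij by (intro sum.cong) (auto simp: less_eq_prod_def)
  then have "signed_mass I t i = 1"
    using pos_mass_zero_or_neg_mass_zero[of i] chain_weightsD(3)[OF weights]
    by (auto simp: signed_mass_def)
  moreover have "neg_mass I t j = sum t (disjoint_pairs I)"
    unfolding neg_mass_def using p(2) ij by (intro sum.cong) (auto simp: less_eq_prod_def)
  then have "signed_mass I t j = - 1"
    using pos_mass_zero_or_neg_mass_zero[of j] chain_weightsD(3)[OF weights]
    by (auto simp: signed_mass_def)
  ultimately show "\<exists>i\<in>I. signed_mass I t i = 1" "\<exists>i\<in>I. signed_mass I t i = - 1"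
    using I by blast+
qed

lemma upper_mass_le:
  "i \<in> fst p \<Longrightarrow> upper_mass (disjoint_pairs I) t p \<le> pos_mass I t i"
  "i \<in> snd p \<Longrightarrow> upper_mass (disjoint_pairs I) t p \<le> neg_mass I t i"
  unfolding upper_mass_def pos_mass_def neg_mass_def
  using chain_weightsD(1)[OF weights] by (auto intro!: sum_mono simp: less_eq_prod_def)

text \<open>The supporting pairs not above \<open>p\<close> form a chain; let \<open>r\<close> be
  its largest member. As \<open>p\<close> is not below \<open>r\<close>, some element of a component
  of \<open>p\<close> is missing from that component of \<open>r\<close>, hence from all of these
  pairs, and so occurs there only in supporting pairs above \<open>p\<close>. Together with
  \<open>upper_mass_le\<close>, this exhibits the upper mass of \<open>p\<close> as the minimum of
  the positive masses on \<open>fst p\<close> and the negative masses on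
  \<open>snd p\<close>.\<close>

lemma upper_mass_attained:
  assumes "p \<in> disjoint_pairs I"
  shows "(\<exists>i\<in>fst p. pos_mass I t i \<le> upper_mass (disjoint_pairs I) t p) \<or>
         (\<exists>i\<in>snd p. neg_mass I t i \<le> upper_mass (disjoint_pairs I) t p)"
proof -
  let ?N = "{q \<in> disjoint_pairs I. t q \<noteq> 0 \<and> \<not> p \<le> q}"
  have "\<exists>i. i \<in> fst p \<and> (\<forall>q. t q \<noteq> 0 \<longrightarrow> i \<in> fst q \<longrightarrow> p \<le> q) \<or>
            i \<in> snd p \<and> (\<forall>q. t q \<noteq> 0 \<longrightarrow> i \<in> snd q \<longrightarrow> p \<le> q)"
  proof (cases "?N = {}")
    case True
    then have "p \<le> q" if "t q \<noteq> 0" for q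
      using that chain_weightsD(2)[OF weights, of q] by blast
    moreover have "fst p \<noteq> {}"
      using assms by (auto simp: disjoint_pairs_def)
    ultimately show ?thesis
      by blast
  next
    case False
    then obtain r where r: "r \<in> ?N" "\<And>q. q \<in> ?N \<Longrightarrow> r \<le> q \<Longrightarrow> r = q"
      using finite_has_maximal[of ?N] finite_disjoint_pairs[OF finite_index] by auto
    have le: "q \<le> r" if "t q \<noteq> 0" "\<not> p \<le> q" for q
    proof -
      have "q \<in> ?N"
        using that chain_weightsD(2)[OF weights, of q] by blast
      moreover have "q \<le> r \<or> r \<le> q"
        using that r(1) by (intro chain_weightsD(4)[OF weights]) auto
      ultimately show ?thesis
        using r(2) by blast
    qed
    from r(1) obtain i where "i \<in> fst p \<and> i \<notin> fst r \<or> i \<in> snd p \<and> i \<notin> snd r"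
      by (auto simp: less_eq_prod_def)
    moreover have "fst q \<subseteq> fst r" "snd q \<subseteq> snd r" if "t q \<noteq> 0" "\<not> p \<le> q" for q
      using le[OF that] by (simp_all add: less_eq_prod_def)
    ultimately show ?thesis
      by (intro exI[of _ i]) blast
  qed
  then obtain i where i: "i \<in> fst p \<and> (\<forall>q. t q \<noteq> 0 \<longrightarrow> i \<in> fst q \<longrightarrow> p \<le> q) \<or>
      i \<in> snd p \<and> (\<forall>q. t q \<noteq> 0 \<longrightarrow> i \<in> snd q \<longrightarrow> p \<le> q)"
    by blast
  have nn: "0 \<le> t q" for q
    by (rule chain_weightsD(1)[OF weights])
  have "pos_mass I t i \<le> upper_mass (disjoint_pairs I) t p"
    if "\<forall>q. t q \<noteq> 0 \<longrightarrow> i \<in> fst q \<longrightarrow> p \<le> q"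
    unfolding upper_mass_def pos_mass_def
  proof (rule sum_mono)
    fix q
    show "(if i \<in> fst q then t q else 0) \<le> (if p \<le> q then t q else 0)"
      using spec[OF that, of q] nn[of q] by auto
  qed
  moreover have "neg_mass I t i \<le> upper_mass (disjoint_pairs I) t p"
    if "\<forall>q. t q \<noteq> 0 \<longrightarrow> i \<in> snd q \<longrightarrow> p \<le> q"
    unfolding upper_mass_def neg_mass_def
  proof (rule sum_mono)
    fix q
    show "(if i \<in> snd q then t q else 0) \<le> (if p \<le> q then t q else 0)"
      using spec[OF that, of q] nn[of q] by auto
  qed
  ultimately show ?thesis
    using i by blast
qed

end

text \<open>The signed mass determines the positive and negative masses as its two parts, their
  minima over a pair are the upper masses, and the upper masses determine the weights.\<close>

lemma signed_mass_inject:
  assumes I: "finite I" and t: "t \<in> chain_weights (disjoint_pairs I)"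
    and t': "t' \<in> chain_weights (disjoint_pairs I)"
    and eq: "\<And>i. i \<in> I \<Longrightarrow> signed_mass I t i = signed_mass I t' i"
  shows "t = t'"
proof -
  let ?P = "disjoint_pairs I"
  have *: "upper_mass ?P x p \<le> upper_mass ?P y p"
    if x: "x \<in> chain_weights ?P" and y: "y \<in> chain_weights ?P" and p: "p \<in> ?P"
      and eq: "\<And>i. i \<in> I \<Longrightarrow> signed_mass I x i = signed_mass I y i" for x y p
  proof -
    have sub: "fst p \<subseteq> I" "snd p \<subseteq> I"
      using p by (auto simp: disjoint_pairs_def)
    show ?thesis
      using upper_mass_attained[OF I y p]
    proof (elim disjE bexE)
      fix i assume i: "i \<in> fst p" and "pos_mass I y i \<le> upper_mass ?P y p"
      moreover have "pos_mass I x i = pos_mass I y i"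
        using eq[of i] i sub by (auto simp: pos_mass_eq[OF I x] pos_mass_eq[OF I y])
      ultimately show ?thesis
        using upper_mass_le(1)[OF I x i] by linarith
    next
      fix i assume i: "i \<in> snd p" and "neg_mass I y i \<le> upper_mass ?P y p"
      moreover have "neg_mass I x i = neg_mass I y i"
        using eq[of i] i sub by (auto simp: neg_mass_eq[OF I x] neg_mass_eq[OF I y])
      ultimately show ?thesis
        using upper_mass_le(2)[OF I x i] by linarith
    qed
  qed
  show ?thesis
    using *[OF t t'] *[OF t' t] eq
    by (intro chain_weights_eqI[OF finite_disjoint_pairs[OF I] t t'] antisym) simp_all
qed

text \<open>Both signed masses have maximum 1 and minimum -1 on \<open>I\<close>. A map
  \<open>x \<mapsto> a * x + c\<close> with \<open>0 \<le> a\<close> carries maximum to maximum and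
  minimum to minimum, so \<open>a + c = 1\<close> and \<open>- a + c = - 1\<close>, which forces
  \<open>a = 1\<close> and \<open>c = 0\<close>.\<close>

lemma signed_mass_inject_affine:
  assumes I: "finite I" and t: "t \<in> chain_weights (disjoint_pairs I)"
    and t': "t' \<in> chain_weights (disjoint_pairs I)" and a: "0 \<le> a"
    and eq: "\<And>i. i \<in> I \<Longrightarrow> signed_mass I t' i = a * signed_mass I t i + c"
  shows "t = t'"
proof -
  obtain i i' j j' where ij: "i \<in> I" "signed_mass I t i = 1" "i' \<in> I" "signed_mass I t' i' = 1"
    "j \<in> I" "signed_mass I t j = - 1" "j' \<in> I" "signed_mass I t' j' = - 1"
    using signed_mass_extremal[OF I t] signed_mass_extremal[OF I t'] by blast
  have "a + c \<le> 1" "- a + c \<ge> - 1"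
    using eq[OF ij(1)] eq[OF ij(5)] ij signed_mass_bounds[OF I t', of i]
      signed_mass_bounds[OF I t', of j] by simp_all
  moreover have "1 \<le> a + c"
    using eq[OF ij(3)] ij(4) mult_left_mono[OF signed_mass_bounds(2)[OF I t, of i'] a] by linarith
  moreover have "- 1 \<ge> - a + c"
    using eq[OF ij(7)] ij(8) mult_left_mono[OF signed_mass_bounds(1)[OF I t, of j'] a] by linarith
  ultimately have "a = 1" "c = 0"
    by linarith+
  with eq show ?thesis
    by (intro signed_mass_inject[OF I t t']) simp
qed

text \<open>
  The weight of a pair is the length of the set of levels \<open>s\<close> at which it is the pair of
  superlevel and sublevel sets of the prescribed function at \<open>s\<close> and \<open>-s\<close>.
\<close>
lemma signed_mass_surj:
  fixes v :: "'a \<Rightarrow> real"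
  assumes I: "finite I" and bound: "\<And>i. i \<in> I \<Longrightarrow> \<bar>v i\<bar> \<le> 1"
    and hi: "i1 \<in> I" "v i1 = 1" and lo: "i0 \<in> I" "v i0 = - 1"
  obtains t where "t \<in> chain_weights (disjoint_pairs I)"
    "\<And>i. i \<in> I \<Longrightarrow> signed_mass I t i = v i"
proof -
  let ?P = "disjoint_pairs I"
  define lev where "lev s = ({i \<in> I. s < v i}, {i \<in> I. v i < - s})" for s
  define t where "t p = measure lborel {s \<in> {0..<1}. lev s = p}" for p
  \<comment> \<open>The two sets are disjoint because \<open>0 \<le> s\<close>, and nonempty because
    \<open>s < 1\<close> puts \<open>i1\<close> into the first and \<open>i0\<close> into the
    second.\<close>
  have lev_mem: "lev s \<in> ?P" if "s \<in> {0..<1}" for s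
    using that hi lo by (auto simp: lev_def disjoint_pairs_def)
  have lev_anti: "lev s' \<le> lev s" if "s \<le> s'" for s s'
    using that by (auto simp: lev_def less_eq_prod_def)
  have meas: "{s \<in> {0..<1}. lev s = p} \<in> sets lborel" for p
  proof (cases "fst p \<subseteq> I \<and> snd p \<subseteq> I")
    case True
    have "(lev s = p) = (\<forall>i\<in>I. (s < v i \<longleftrightarrow> i \<in> fst p) \<and> (v i < - s \<longleftrightarrow> i \<in> snd p))" for s
      using True by (auto simp: lev_def prod_eq_iff)
    then have "{s \<in> {0..<1}. lev s = p} = {s \<in> space borel. 0 \<le> s \<and> s < 1 \<and>
        (\<forall>i\<in>I. (s < v i \<longleftrightarrow> i \<in> fst p) \<and> (v i < - s \<longleftrightarrow> i \<in> snd p))}"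
      by auto
    also have "\<dots> \<in> sets borel"
      using I by measurable
    finally show ?thesis
      by simp
  next
    case False
    then have "lev s \<noteq> p" for s
      by (auto simp: lev_def)
    then show ?thesis
      by simp
  qed
  have sum_t: "sum t Q = measure lborel {s \<in> {0..<1}. lev s \<in> Q}" if "Q \<subseteq> ?P" for Q
  proof -
    have "measure lborel (\<Union>p\<in>Q. {s \<in> {0..<1}. lev s = p}) = sum t Q"
      unfolding t_def
    proof (rule measure_finite_Union)
      show "finite Q"
        using that finite_disjoint_pairs[OF I] finite_subset by blast
      show "emeasure lborel {s \<in> {0..<1}. lev s = p} \<noteq> \<infinity>" for p
      proof -
        have "emeasure lborel {s \<in> {0..<1}. lev s = p} \<le> emeasure lborel {0..<1::real}"
          by (rule emeasure_mono) auto
        then show ?thesis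
          by (auto simp: top_unique)
      qed
    qed (use meas in \<open>auto simp: disjoint_family_on_def\<close>)
    then show ?thesis
      by (simp add: UN_iff Collect_bex_eq[symmetric] Bex_def conj_commute)
  qed
  have "sum t ?P = 1"
  proof -
    have "{s \<in> {0..<1}. lev s \<in> ?P} = {0..<1}"
      using lev_mem by blast
    then show ?thesis
      using sum_t[OF order_refl] by simp
  qed
  \<comment> \<open>A pair carrying weight occurs at some level. This places it in
    \<open>?P\<close>, and since \<open>lev\<close> is antitone in \<open>s\<close> any two such
    pairs are comparable.\<close>
  moreover have nz: "\<exists>s\<in>{0..<1}. lev s = p" if "t p \<noteq> 0" for p
  proof (rule ccontr)
    assume "\<not> ?thesis"
    then have "{s \<in> {0..<1}. lev s = p} = {}"
      by blast
    then show False
      using that unfolding t_def by (simp only: measure_empty)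
  qed
  moreover have "p \<le> q \<or> q \<le> p" if "t p \<noteq> 0" "t q \<noteq> 0" for p q
    using nz[OF that(1)] nz[OF that(2)] lev_anti linear by metis
  moreover have "0 \<le> t p" for p
    by (simp add: t_def)
  ultimately have t: "t \<in> chain_weights ?P"
    unfolding chain_weights_def using lev_mem by blast
  have "signed_mass I t i = v i" if i: "i \<in> I" for i
  proof -
    \<comment> \<open>Layer-cake formula: \<open>i\<close> belongs to the first set exactly at the
      levels \<open>0 \<le> s < v i\<close>, an interval inside [0,1) of length
      \<open>max 0 (v i)\<close>; the negative side is symmetric.\<close>
    have "pos_mass I t i = sum t {p \<in> ?P. i \<in> fst p}"
      unfolding pos_mass_def using finite_disjoint_pairs[OF I] by (simp add: sum.inter_filter)
    also have "\<dots> = measure lborel {s \<in> {0..<1}. lev s \<in> {p \<in> ?P. i \<in> fst p}}"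
      by (rule sum_t) auto
    also have "{s \<in> {0..<1}. lev s \<in> {p \<in> ?P. i \<in> fst p}} = {0..<max 0 (v i)}"
      using lev_mem bound[OF i] i by (auto simp: lev_def)
    finally have pos: "pos_mass I t i = max 0 (v i)"
      by simp
    have "neg_mass I t i = sum t {p \<in> ?P. i \<in> snd p}"
      unfolding neg_mass_def using finite_disjoint_pairs[OF I] by (simp add: sum.inter_filter)
    also have "\<dots> = measure lborel {s \<in> {0..<1}. lev s \<in> {p \<in> ?P. i \<in> snd p}}"
      by (rule sum_t) auto
    also have "{s \<in> {0..<1}. lev s \<in> {p \<in> ?P. i \<in> snd p}} = {0..<max 0 (- v i)}"
      using lev_mem bound[OF i] i by (auto simp: lev_def)
    finally have neg: "neg_mass I t i = max 0 (- v i)"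
      by simp
    show ?thesis
      by (simp add: signed_mass_def pos neg)
  qed
  with t show thesis
    by (rule that)
qed

section \<open>The homeomorphism with the sphere\<close>

text \<open>Subtracting the value at \<open>m\<close> picks coordinates on R^m/R(1,...,1), and
  division by the Euclidean norm picks a point on each ray. The index shift \<open>Suc k\<close>
  matches the coordinates 0 to \<open>m - 2\<close> of \<open>nsphere (m - 2)\<close>, whose points
  vanish at all later indices.\<close>

definition sphere_map :: "nat \<Rightarrow> (nat set \<times> nat set \<Rightarrow> real) \<Rightarrow> nat \<Rightarrow> real" where
  "sphere_map m t k =
     (if k \<le> m - 2
      then (signed_mass {1..m} t (Suc k) - signed_mass {1..m} t m) /
           sqrt (\<Sum>j\<le>m - 2. (signed_mass {1..m} t (Suc j) - signed_mass {1..m} t m)\<^sup>2)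
      else 0)"

text \<open>A continuous bijection from a compact space to a Hausdorff space is a homeomorphism.
  Injectivity and surjectivity hold because each class of nonconstant vectors modulo positive
  scaling and constants has exactly one representative with maximum 1 and minimum -1.\<close>

lemma homeomorphic_disjoint_pairs_nsphere:
  assumes m: "2 \<le> m"
  shows "order_realization (disjoint_pairs {1..m}) homeomorphic_space nsphere (m - 2)"
proof -
  note [simp del] = One_nat_def
  let ?I = "{1..m}"
  let ?X = "order_realization (disjoint_pairs ?I)"
  let ?v = "signed_mass ?I"
  have I: "finite ?I"
    by simp
  define N where "N t = sqrt (\<Sum>j\<le>m - 2. (?v t (Suc j) - ?v t m)\<^sup>2)" for t
  have map: "sphere_map m t k = (if k \<le> m - 2 then (?v t (Suc k) - ?v t m) / N t else 0)" for t k
    by (simp add: sphere_map_def N_def)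
  have index: "i = m \<or> (\<exists>k\<le>m - 2. i = Suc k)" if "i \<in> ?I" for i
  proof (cases i)
    case (Suc k)
    then have "k \<le> m - 2 \<or> i = m"
      using that by simp arith
    with Suc show ?thesis
      by blast
  qed (use that in simp)
  have in_I: "m \<in> ?I" "k \<le> m - 2 \<Longrightarrow> Suc k \<in> ?I" for k
    using m by auto
  \<comment> \<open>A vanishing norm would make the signed mass constant on \<open>?I\<close>,
    although it takes both values 1 and -1.\<close>
  have N_pos: "0 < N t" if t: "t \<in> chain_weights (disjoint_pairs ?I)" for t
  proof (rule ccontr)
    assume "\<not> 0 < N t"
    moreover have "0 \<le> N t"
      by (simp add: N_def sum_nonneg)
    ultimately have "(\<Sum>j\<le>m - 2. (?v t (Suc j) - ?v t m)\<^sup>2) = 0"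
      by (simp add: N_def)
    then have "\<forall>j\<le>m - 2. ?v t (Suc j) = ?v t m"
      by (simp add: sum_nonneg_eq_0_iff)
    then have "?v t i = ?v t m" if "i \<in> ?I" for i
      using index[OF that] by auto
    moreover obtain i j where "i \<in> ?I" "?v t i = 1" "j \<in> ?I" "?v t j = - 1"
      using signed_mass_extremal[OF I t] by blast
    ultimately have "?v t m = 1" "?v t m = - 1"
      by metis+
    then show False
      by simp
  qed
  have N_nz: "N t \<noteq> 0" if "t \<in> chain_weights (disjoint_pairs ?I)" for t
    using N_pos[OF that] by simp
  have "homeomorphic_map ?X (nsphere (m - 2)) (sphere_map m)"
  proof (rule continuous_imp_homeomorphic_map)
    show "compact_space ?X"
      by (intro compact_space_order_realization finite_disjoint_pairs I)
    show "Hausdorff_space (nsphere (m - 2))"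
      unfolding nsphere_def by (intro Hausdorff_space_subtopology Hausdorff_Euclidean_space)
    have v: "continuous_map ?X euclideanreal (\<lambda>t. ?v t i)" for i
    proof -
      have p: "continuous_map ?X euclideanreal (\<lambda>t. t p)" for p
        by (intro continuous_map_from_subtopology continuous_map_product_projection) simp
      have q: "continuous_map ?X euclideanreal (\<lambda>t. if b then t p else 0)" for b p
        using p by (cases b) simp_all
      show ?thesis
        unfolding signed_mass_def pos_mass_def neg_mass_def
        by (intro continuous_map_diff continuous_map_sum finite_disjoint_pairs I q)
    qed
    have N: "continuous_map ?X euclideanreal N"
      unfolding N_def
      by (intro continuous_map_sqrt continuous_map_sum continuous_map_real_pow
          continuous_map_diff v) simp
    have cont: "continuous_map ?X euclideanreal (\<lambda>t. sphere_map m t k)" for k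
    proof (cases "k \<le> m - 2")
      case True
      then show ?thesis
        by (auto simp: map N_nz intro!: continuous_map_real_divide continuous_map_diff v N)
    qed (simp add: map)
    have "(\<Sum>k\<le>m - 2. (sphere_map m t k)\<^sup>2) = 1"
      if "t \<in> chain_weights (disjoint_pairs ?I)" for t
    proof -
      have "(\<Sum>k\<le>m - 2. (sphere_map m t k)\<^sup>2) = (\<Sum>k\<le>m - 2. (?v t (Suc k) - ?v t m)\<^sup>2) / (N t)\<^sup>2"
        by (simp add: map power_divide sum_divide_distrib)
      also have "(\<Sum>k\<le>m - 2. (?v t (Suc k) - ?v t m)\<^sup>2) = (N t)\<^sup>2"
        by (simp add: N_def sum_nonneg)
      finally show ?thesis
        using N_pos[OF that] by simp
    qed
    then show *: "continuous_map ?X (nsphere (m - 2)) (sphere_map m)"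
      using cont
      by (auto simp: nsphere continuous_map_in_subtopology continuous_map_componentwise_UNIV map)
    show "inj_on (sphere_map m) (topspace ?X)"
    proof (rule inj_onI)
      fix t t' assume "t \<in> topspace ?X" "t' \<in> topspace ?X" and eq: "sphere_map m t = sphere_map m t'"
      then have t: "t \<in> chain_weights (disjoint_pairs ?I)"
        and t': "t' \<in> chain_weights (disjoint_pairs ?I)"
        by simp_all
      \<comment> \<open>Equal images mean that the differences from the value at \<open>m\<close>
        are proportional with factor \<open>N t' / N t\<close>; the constant collects the two values
        at \<open>m\<close>.\<close>
      have affine: "?v t' i = N t' / N t * ?v t i + (?v t' m - N t' / N t * ?v t m)" if i: "i \<in> ?I" for i
        using index[OF i]
      proof (elim disjE exE conjE)
        fix k assume k: "k \<le> m - 2" "i = Suc k"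
        then have "(?v t i - ?v t m) / N t = (?v t' i - ?v t' m) / N t'"
          using fun_cong[OF eq, of k] by (simp add: map)
        then have "?v t' i - ?v t' m = N t' * ((?v t i - ?v t m) / N t)"
          using N_nz[OF t'] by simp
        then show ?thesis
          by (simp add: right_diff_distrib diff_divide_distrib)
      qed simp
      have "0 \<le> N t' / N t"
        using N_pos[OF t] N_pos[OF t'] by simp
      then show "t = t'"
        by (rule signed_mass_inject_affine[OF I t t' _ affine])
    qed
    show "sphere_map m ` topspace ?X = topspace (nsphere (m - 2))"
    proof
      show "sphere_map m ` topspace ?X \<subseteq> topspace (nsphere (m - 2))"
        using * by (rule continuous_map_image_subset_topspace)
      show "topspace (nsphere (m - 2)) \<subseteq> sphere_map m ` topspace ?X"
      proof
        fix y assume "y \<in> topspace (nsphere (m - 2))"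
        then have y: "(\<Sum>k\<le>m - 2. (y k)\<^sup>2) = 1" "\<And>k. k > m - 2 \<Longrightarrow> y k = 0"
          by (auto simp: nsphere)
        \<comment> \<open>Lifts \<open>y\<close> to a vector on \<open>?I\<close>; its entry at
          \<open>m\<close> is \<open>y (m - 1)\<close>, which is 0 because \<open>m - 1\<close>
          exceeds \<open>m - 2\<close>.\<close>
        define u where "u i = y (i - 1)" for i
        define hi where "hi = Max (u ` ?I)"
        define lo where "lo = Min (u ` ?I)"
        have "hi \<in> u ` ?I" "lo \<in> u ` ?I"
          unfolding hi_def lo_def using m by (auto intro!: Max_in Min_in simp del: image_eqI)
        then obtain i1 i0 where i: "i1 \<in> ?I" "u i1 = hi" "i0 \<in> ?I" "u i0 = lo"
          by blast
        have bounds: "lo \<le> u i" "u i \<le> hi" if "i \<in> ?I" for i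
          using that by (simp_all add: hi_def lo_def)
        have um: "u m = 0"
          using m by (simp add: u_def y(2))
        \<comment> \<open>Otherwise \<open>u\<close> is constant and equal to
          \<open>u m = 0\<close>, so \<open>y\<close> would vanish instead of having norm 1.\<close>
        have "lo < hi"
        proof (rule ccontr)
          assume "\<not> lo < hi"
          then have "u i = u m" if "i \<in> ?I" for i
            using bounds[OF that] bounds[of m] m by simp
          then have "u (Suc k) = 0" if "k \<le> m - 2" for k
            using in_I(2)[OF that] um by simp
          then have "y k = 0" if "k \<le> m - 2" for k
            using that by (simp add: u_def)
          then show False
            using y(1) by simp
        qed
        \<comment> \<open>The increasing affine rescaling of \<open>u\<close> that sends
          \<open>hi\<close> to 1 and \<open>lo\<close> to -1.\<close>
        define v where "v i = (2 * u i - hi - lo) / (hi - lo)" for i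
        have "\<bar>v i\<bar> \<le> 1" if "i \<in> ?I" for i
          using bounds[OF that] \<open>lo < hi\<close> by (auto simp: v_def abs_le_iff field_simps)
        moreover have "v i1 = 1" "v i0 = - 1"
          using i \<open>lo < hi\<close> by (simp_all add: v_def field_simps)
        ultimately obtain t where t: "t \<in> chain_weights (disjoint_pairs ?I)"
          and vt: "\<And>i. i \<in> ?I \<Longrightarrow> ?v t i = v i"
          using signed_mass_surj[OF I, of v i1 i0] i by metis
        \<comment> \<open>The slope of the rescaling. Differences of signed masses are
          \<open>c * y k\<close>, so the norm is \<open>c\<close> and normalizing returns
          \<open>y\<close>.\<close>
        define c where "c = 2 / (hi - lo)"
        have "0 < c"
          using \<open>lo < hi\<close> by (simp add: c_def)
        have diff: "?v t (Suc k) - ?v t m = c * y k" if "k \<le> m - 2" for k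
        proof -
          have "?v t (Suc k) = v (Suc k)" "?v t m = v m"
            using in_I(1) in_I(2)[OF that] by (simp_all only: vt)
          then show ?thesis
            using um by (simp add: v_def c_def u_def diff_divide_distrib[symmetric])
        qed
        have "(\<Sum>k\<le>m - 2. (?v t (Suc k) - ?v t m)\<^sup>2) = c\<^sup>2 * (\<Sum>k\<le>m - 2. (y k)\<^sup>2)"
          unfolding sum_distrib_left using diff by (intro sum.cong) (simp_all add: power_mult_distrib)
        then have "N t = c"
          using y(1) \<open>0 < c\<close> by (simp add: N_def)
        then have "sphere_map m t = y"
          using diff y(2) \<open>0 < c\<close> by (auto simp: map fun_eq_iff)
        with t show "y \<in> sphere_map m ` topspace ?X"
          by auto
      qed
    qed
  qed
  then show ?thesis
    by (rule homeomorphic_map_imp_homeomorphic_space)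
qed

section \<open>The complex of homomorphisms\<close>

definition product_cells :: "nat \<Rightarrow> nat \<Rightarrow> (nat \<times> nat \<Rightarrow> nat set) set" where
  "product_cells m n =
     hom_cells (categorical_product (complete_graph 2) (complete_graph n)) (complete_graph m)"

text \<open>Edges of the product join (1,i) and (2,j) with \<open>i \<noteq> j\<close>, in both
  directions, and a product of two subsets of {1..m} consists of edges of K_m iff the subsets are
  disjoint. By symmetry of disjointness, both directions give one condition.\<close>

lemma product_cells_iff:
  "\<eta> \<in> product_cells m n \<longleftrightarrow>
     \<eta> \<in> extensional ({1, 2} \<times> {1..n}) \<and>
     (\<forall>i\<in>{1..n}. \<eta> (1, i) \<noteq> {} \<and> \<eta> (1, i) \<subseteq> {1..m} \<and> \<eta> (2, i) \<noteq> {} \<and> \<eta> (2, i) \<subseteq> {1..m}) \<and>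
     (\<forall>i\<in>{1..n}. \<forall>j\<in>{1..n}. i \<noteq> j \<longrightarrow> \<eta> (1, i) \<inter> \<eta> (2, j) = {})"
proof -
  note [simp del] = One_nat_def
  let ?G = "categorical_product (complete_graph 2) (complete_graph n)"
  have two: "{1..2::nat} = {1, 2}"
    by auto
  have verts: "pverts ?G = {1, 2} \<times> {1..n}" "pverts (complete_graph m) = {1..m}"
    by (simp_all add: categorical_product_def complete_graph_def two)
  have arcs: "((a, i), (b, j)) \<in> parcs ?G \<longleftrightarrow>
      (a = 1 \<and> b = 2 \<or> a = 2 \<and> b = 1) \<and> i \<in> {1..n} \<and> j \<in> {1..n} \<and> i \<noteq> j" for a b i j
    unfolding categorical_product_def complete_graph_def two by auto
  have disj: "A \<times> B \<subseteq> parcs (complete_graph m) \<longleftrightarrow> A \<inter> B = {}"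
    if "A \<subseteq> {1..m}" "B \<subseteq> {1..m}" for A B
    using that unfolding complete_graph_def by auto
  have maps: "\<eta> \<in> pverts ?G \<rightarrow>\<^sub>E Pow (pverts (complete_graph m)) - {{}} \<longleftrightarrow>
      \<eta> \<in> extensional ({1, 2} \<times> {1..n}) \<and>
      (\<forall>i\<in>{1..n}. \<eta> (1, i) \<noteq> {} \<and> \<eta> (1, i) \<subseteq> {1..m} \<and> \<eta> (2, i) \<noteq> {} \<and> \<eta> (2, i) \<subseteq> {1..m})"
    unfolding verts PiE_iff by auto
  have edge: "(\<forall>(v, w)\<in>parcs ?G. \<eta> v \<times> \<eta> w \<subseteq> parcs (complete_graph m)) \<longleftrightarrow>
      (\<forall>i\<in>{1..n}. \<forall>j\<in>{1..n}. i \<noteq> j \<longrightarrow> \<eta> (1, i) \<inter> \<eta> (2, j) = {})"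
    if "\<forall>i\<in>{1..n}. \<eta> (1, i) \<noteq> {} \<and> \<eta> (1, i) \<subseteq> {1..m} \<and> \<eta> (2, i) \<noteq> {} \<and> \<eta> (2, i) \<subseteq> {1..m}"
  proof (intro iffI ballI impI)
    fix i j assume "\<forall>(v, w)\<in>parcs ?G. \<eta> v \<times> \<eta> w \<subseteq> parcs (complete_graph m)"
      and ij: "i \<in> {1..n}" "j \<in> {1..n}" "i \<noteq> j"
    then have "\<eta> (1, i) \<times> \<eta> (2, j) \<subseteq> parcs (complete_graph m)"
      using arcs[of 1 i 2 j] by blast
    then show "\<eta> (1, i) \<inter> \<eta> (2, j) = {}"
      using disj[of "\<eta> (1, i)" "\<eta> (2, j)"] that ij by blast
  next
    fix e assume D: "\<forall>i\<in>{1..n}. \<forall>j\<in>{1..n}. i \<noteq> j \<longrightarrow> \<eta> (1, i) \<inter> \<eta> (2, j) = {}" and mem: "e \<in> parcs ?G"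
    obtain a i b j where e: "e = ((a, i), (b, j))"
      by (metis surj_pair)
    have ij: "(a = 1 \<and> b = 2 \<or> a = 2 \<and> b = 1)" "i \<in> {1..n}" "j \<in> {1..n}" "i \<noteq> j"
      using mem[unfolded e arcs] by blast+
    from ij(1) have "\<eta> (a, i) \<inter> \<eta> (b, j) = {} \<and> \<eta> (a, i) \<subseteq> {1..m} \<and> \<eta> (b, j) \<subseteq> {1..m}"
    proof (elim disjE conjE)
      assume "a = 1" "b = 2"
      then show ?thesis
        using D that ij by simp
    next
      assume "a = 2" "b = 1"
      then show ?thesis
        using D[rule_format, of j i] that ij by (simp add: Int_commute)
    qed
    then show "case e of (v, w) \<Rightarrow> \<eta> v \<times> \<eta> w \<subseteq> parcs (complete_graph m)"
      using disj[of "\<eta> (a, i)" "\<eta> (b, j)"] by (simp add: e)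
  qed
  show ?thesis
    unfolding product_cells_def hom_cells_def mem_Collect_eq maps using edge by blast
qed

definition repeated :: "nat \<Rightarrow> (nat \<times> nat \<Rightarrow> nat set) \<Rightarrow> nat \<Rightarrow> nat set" where
  "repeated n \<eta> a = {x. \<exists>i\<in>{1..n}. \<exists>j\<in>{1..n}. i \<noteq> j \<and> x \<in> \<eta> (a, i) \<and> x \<in> \<eta> (a, j)}"

lemma repeated_mono:
  "(\<And>i. i \<in> {1..n} \<Longrightarrow> \<eta> (a, i) \<subseteq> \<theta> (a, i)) \<Longrightarrow> repeated n \<eta> a \<subseteq> repeated n \<theta> a"
  unfolding repeated_def by blast

text \<open>Pigeonhole: a choice of one element from each of the \<open>n\<close> sets takes values
  in {1..m} and cannot be injective, and a value chosen twice lies in two of the sets.\<close>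

lemma repeated_nonempty:
  assumes "m < n" and "\<And>i. i \<in> {1..n} \<Longrightarrow> \<eta> (a, i) \<noteq> {} \<and> \<eta> (a, i) \<subseteq> {1..m}"
  shows "repeated n \<eta> a \<noteq> {}"
proof -
  have "\<forall>i\<in>{1..n}. \<exists>x. x \<in> \<eta> (a, i)"
    using assms(2) by blast
  then obtain f where f: "\<And>i. i \<in> {1..n} \<Longrightarrow> f i \<in> \<eta> (a, i)"
    by metis
  have "f ` {1..n} \<subseteq> {1..m}"
    using f assms(2) by blast
  then have "\<not> inj_on f {1..n}"
    using card_inj_on_le[of f "{1..n}" "{1..m}"] assms(1) by auto
  then obtain i j where "i \<in> {1..n}" "j \<in> {1..n}" "i \<noteq> j" "f i = f j"
    unfolding inj_on_def by blast
  moreover from this have "f i \<in> \<eta> (a, i)" "f i \<in> \<eta> (a, j)"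
    using f[of i] f[of j] by simp_all
  ultimately have "f i \<in> repeated n \<eta> a"
    unfolding repeated_def by blast
  then show ?thesis
    by blast
qed

theorem mainTheorem4:
  fixes m n :: nat
  assumes "2 \<le> m" and "m < n"
  shows "Hom_complex (categorical_product (complete_graph 2) (complete_graph n)) (complete_graph m)
           homotopy_equivalent_space nsphere (m - 2)"
proof -
  note [simp del] = One_nat_def
  let ?G = "categorical_product (complete_graph 2) (complete_graph n)"
  let ?V = "{1, 2::nat} \<times> {1..n}"
  let ?X = "product_cells m n"
  let ?Y = "disjoint_pairs {1..m}"
  have verts: "pverts ?G = ?V"
    by (auto simp: categorical_product_def complete_graph_def)
  have finX: "finite ?X"
    unfolding product_cells_def
    by (rule finite_hom_cells) (simp_all add: verts, simp add: complete_graph_def)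
  have ext: "\<eta> x = undefined" if "\<eta> \<in> ?X" "x \<notin> ?V" for \<eta> x
    using that unfolding product_cells_iff extensional_def by blast
  \<comment> \<open>Cells all take the value \<open>undefined\<close> off the vertex set, so the
    face relation is the pointwise order of functions.\<close>
  have face: "hom_face ?G \<eta> \<theta> \<longleftrightarrow> \<eta> \<le> \<theta>" if "\<eta> \<in> ?X" "\<theta> \<in> ?X" for \<eta> \<theta>
    unfolding hom_face_def verts le_fun_def using ext[OF that(1)] ext[OF that(2)]
    by (metis order_refl)
  \<comment> \<open>\<open>r\<close> retracts a cell to its pair of repeated sets, \<open>c\<close>
    embeds a pair as two constant families, and \<open>g\<close> is the common upper bound of the
    identity and \<open>c \<circ> r\<close>.\<close>
  define r where "r \<eta> = (repeated n \<eta> 1, repeated n \<eta> 2)" for \<eta> :: "nat \<times> nat \<Rightarrow> nat set"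
  define c where "c p = restrict (\<lambda>(a, i). if a = 1 then fst p else snd p) ?V"
    for p :: "nat set \<times> nat set"
  define g where "g \<eta> = restrict (\<lambda>(a, i). \<eta> (a, i) \<union> repeated n \<eta> a) ?V"
    for \<eta> :: "nat \<times> nat \<Rightarrow> nat set"
  have c_app: "c p (1, i) = fst p" "c p (2, i) = snd p" if "i \<in> {1..n}" for p i
    using that by (simp_all add: c_def)
  have g_app: "g \<eta> (1, i) = \<eta> (1, i) \<union> repeated n \<eta> 1" "g \<eta> (2, i) = \<eta> (2, i) \<union> repeated n \<eta> 2"
    if "i \<in> {1..n}" for \<eta> i
    using that by (simp_all add: g_def)
  have leI: "\<eta> \<le> \<theta>"
    if "\<eta> \<in> extensional ?V" "\<theta> \<in> extensional ?V"
      "\<And>i. i \<in> {1..n} \<Longrightarrow> \<eta> (1, i) \<subseteq> \<theta> (1, i) \<and> \<eta> (2, i) \<subseteq> \<theta> (2, i)"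
    for \<eta> \<theta> :: "nat \<times> nat \<Rightarrow> nat set"
  proof (rule le_funI)
    fix x
    show "\<eta> x \<le> \<theta> x"
    proof (cases "x \<in> ?V")
      case True
      then obtain i where "i \<in> {1..n}" "x = (1, i) \<or> x = (2, i)"
        by blast
      then show ?thesis
        using that(3)[of i] by blast
    next
      case False
      then show ?thesis
        by (simp only: extensional_arb[OF that(1) False] extensional_arb[OF that(2) False] order_refl)
    qed
  qed
  have extX: "\<eta> \<in> extensional ?V" if "\<eta> \<in> ?X" for \<eta>
    using that unfolding product_cells_iff by blast
  have cext: "c p \<in> extensional ?V" and gext: "g \<eta> \<in> extensional ?V" for p \<eta>
    by (simp_all add: c_def g_def)
  have cellD: "\<eta> (1, i) \<noteq> {} \<and> \<eta> (1, i) \<subseteq> {1..m}" "\<eta> (2, i) \<noteq> {} \<and> \<eta> (2, i) \<subseteq> {1..m}"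
    if "\<eta> \<in> ?X" "i \<in> {1..n}" for \<eta> i
    using that unfolding product_cells_iff by blast+
  have cell_disj: "\<eta> (1, i) \<inter> \<eta> (2, j) = {}"
    if "\<eta> \<in> ?X" "i \<in> {1..n}" "j \<in> {1..n}" "i \<noteq> j" for \<eta> i j
    using that unfolding product_cells_iff by blast
  \<comment> \<open>A vertex lying in two different sets \<open>\<eta> (a, i)\<close> is excluded from all \<open>\<eta> (b, j)\<close> with
    \<open>b \<noteq> a\<close>, because every \<open>j\<close> differs from one of the two indices.\<close>
  have excl: "repeated n \<eta> 1 \<inter> \<eta> (2, j) = {}" "repeated n \<eta> 2 \<inter> \<eta> (1, j) = {}"
    if \<eta>: "\<eta> \<in> ?X" and j: "j \<in> {1..n}" for \<eta> j
  proof -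
    have "x \<notin> \<eta> (2, j)" if x: "x \<in> repeated n \<eta> 1" for x
    proof -
      obtain i i' where i: "i \<in> {1..n}" "i' \<in> {1..n}" "i \<noteq> i'" "x \<in> \<eta> (1, i)" "x \<in> \<eta> (1, i')"
        using x unfolding repeated_def by blast
      then show ?thesis
        using cell_disj[OF \<eta> i(1) j] cell_disj[OF \<eta> i(2) j] by blast
    qed
    then show "repeated n \<eta> 1 \<inter> \<eta> (2, j) = {}"
      by blast
    have "x \<notin> \<eta> (1, j)" if x: "x \<in> repeated n \<eta> 2" for x
    proof -
      obtain i i' where i: "i \<in> {1..n}" "i' \<in> {1..n}" "i \<noteq> i'" "x \<in> \<eta> (2, i)" "x \<in> \<eta> (2, i')"
        using x unfolding repeated_def by blast
      then show ?thesis
        using cell_disj[OF \<eta> j i(1)] cell_disj[OF \<eta> j i(2)] by blast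
    qed
    then show "repeated n \<eta> 2 \<inter> \<eta> (1, j) = {}"
      by blast
  qed
  have sub: "repeated n \<eta> 1 \<subseteq> {1..m}" "repeated n \<eta> 2 \<subseteq> {1..m}" if "\<eta> \<in> ?X" for \<eta>
    using cellD[OF that] unfolding repeated_def by blast+
  have disj: "repeated n \<eta> 1 \<inter> repeated n \<eta> 2 = {}" if "\<eta> \<in> ?X" for \<eta>
    using excl(1)[OF that] unfolding repeated_def by blast
  have ne: "repeated n \<eta> 1 \<noteq> {}" "repeated n \<eta> 2 \<noteq> {}" if "\<eta> \<in> ?X" for \<eta>
    by (rule repeated_nonempty[OF assms(2)]; rule cellD[OF that]; assumption)+
  have rmono: "repeated n \<eta> a \<subseteq> repeated n \<theta> a" if "\<eta> \<le> \<theta>" for \<eta> \<theta> a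
    by (rule repeated_mono) (use that in \<open>simp add: le_fun_def\<close>)
  have "order_realization ?X homotopy_equivalent_space order_realization ?Y"
  proof (rule homotopy_equivalent_order_realization[where r = r and c = c and g = g])
    show "finite ?X" "finite ?Y"
      by (simp_all add: finX finite_disjoint_pairs)
    show "r \<in> ?X \<rightarrow> ?Y"
      using sub ne disj by (auto simp: r_def disjoint_pairs_def)
    show "mono_on ?X r"
      using rmono by (auto simp: mono_on_def r_def)
    show "c \<in> ?Y \<rightarrow> ?X"
      using cext by (auto simp: product_cells_iff c_app disjoint_pairs_def)
    show "mono_on ?Y c"
      by (intro mono_onI leI cext) (simp add: c_app less_eq_prod_def)
    \<comment> \<open>In a constant family every element is repeated as soon as two distinct indices
      exist; 1 and 2 serve, since \<open>2 \<le> m < n\<close>.\<close>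
    show "r (c p) = p" if "p \<in> ?Y" for p
    proof -
      have "(1::nat) \<in> {1..n}" "2 \<in> {1..n}" "(1::nat) \<noteq> 2"
        using assms by auto
      then have "\<exists>i\<in>{1..n}. \<exists>j\<in>{1..n}. i \<noteq> j"
        by blast
      then show ?thesis
        by (auto simp: r_def repeated_def c_app prod_eq_iff)
    qed
    \<comment> \<open>The enlarged sets stay disjoint at distinct indices: original sets by the cell
      condition, a repeated set against an original one by \<open>excl\<close>, and the two repeated
      sets by \<open>disj\<close>.\<close>
    show "g \<in> ?X \<rightarrow> ?X"
    proof
      fix \<eta> assume \<eta>: "\<eta> \<in> ?X"
      then show "g \<eta> \<in> ?X"
        using gext[of \<eta>] sub[OF \<eta>] disj[OF \<eta>] excl[OF \<eta>]
        unfolding product_cells_iff by (simp add: g_app Int_Un_distrib Int_Un_distrib2 Int_commute)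
    qed
    show "mono_on ?X g"
    proof (intro mono_onI leI gext)
      fix \<eta> \<theta> :: "nat \<times> nat \<Rightarrow> nat set" and i assume "\<eta> \<le> \<theta>" and i: "i \<in> {1..n}"
      then show "g \<eta> (1, i) \<subseteq> g \<theta> (1, i) \<and> g \<eta> (2, i) \<subseteq> g \<theta> (2, i)"
        using rmono[of \<eta> \<theta> 1] rmono[of \<eta> \<theta> 2] by (auto simp: g_app[OF i] le_fun_def)
    qed
    fix \<eta> assume \<eta>: "\<eta> \<in> ?X"
    show "\<eta> \<le> g \<eta>"
      by (intro leI gext extX \<eta>) (auto simp: g_app)
    show "c (r \<eta>) \<le> g \<eta>"
      by (intro leI gext cext) (auto simp: c_app g_app r_def)
  qed
  moreover have "Hom_complex ?G (complete_graph m) = order_realization ?X"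
    unfolding Hom_complex_def product_cells_def[symmetric]
    using order_complex_cong[of ?X "hom_face ?G" "(\<le>)"] face
    by (simp add: geometric_realization_order_complex[OF finX])
  ultimately show ?thesis
    using homotopy_eqv_trans homeomorphic_imp_homotopy_equivalent_space[OF
        homeomorphic_disjoint_pairs_nsphere[OF assms(1)]]
    by simp blast
qed

end
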